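(* Let $\mathfrak{Z}$ be an $\mathbb{F}$-Fréchet space and $(M,\mathcal{M})$ a measurable space. Suppose that $(\xi_k)_{k\in\mathbb{N}}$ is a sequence of integrators $\xi_k:\mathcal{M}\to\mathfrak{Z}'$ with common measure $\mu$ and maps $(\Xi_k)_{k\in\mathbb{N}}$, where $\bigcap_k\mathcal{I}(\xi_k)\neq\emptyset$. Assume there exist a map $\Xi:\mathcal{F}(M,\mathfrak{Z}')\to\mathcal{F}(M,\mathfrak{Z}')$ and a unit element $u\in\mathfrak{Z}'$ such that $\Xi(u)$ is $\mathfrak{Z}'$-Gelfand $\mu$-integrable, and where the following holds for any $\gamma\in\bigcap_k\mathcal{I}(\xi_k)$: (1) for any $z\in\mathfrak{Z}$, $x\mapsto\langle\Xi(\gamma)(x),z\rangle$ is $\mu$-measurable; (2) for $\mu$-a.e. $x\in M$, $\Xi_k(\gamma)(x)\to\Xi(\gamma)(x)$ in $(\mathfrak{Z}',\sigma(\mathfrak{Z}',\mathfrak{Z}))$ as $k\to\infty$; (3) for any $z\in\mathfrak{Z}$ there exists $0\leq g^z\in L^1(\mu)$ such that, for every $k\in\mathbb{N}$, $|\langle\Xi_k(\gamma)(x),z\rangle|\leq g^z(x)$ for $\mu$-a.e. $x\in M$. Then $\xi:\mathcal{M}\to\mathfrak{Z}'$ defined as $$\xi(E):=\int_E\Xi(u)(x)\,\mu(dx)$$ is an integrator (with measure $\mu$ and map $\Xi$), $\bigcap_k\mathcal{I}(\xi_k)\subset\mathcal{I}(\xi)$, and for every $\gamma\in\bigcap_k\mathcal{I}(\xi_k)$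 $$\int_M\gamma(x)\,d\xi_k(x)\to\int_M\gamma(x)\,d\xi(x)$$ in $(\mathfrak{Z}',\sigma(\mathfrak{Z}',\mathfrak{Z}))$ as $k\to\infty$.
   Context: $\mathbb{F}\in\{\mathbb{R},\mathbb{C}\}$. A Fréchet space is a metrizable, complete, locally convex topological vector space over $\mathbb{F}$; $\mathfrak{Z}'$ is its topological dual and $\langle z',z\rangle$ the dual pairing. $\sigma(\mathfrak{Z}',\mathfrak{Z})$ is the weak star topology on $\mathfrak{Z}'$, i.e. the coarsest topology making all maps $z'\mapsto\langle z',z\rangle$, $z\in\mathfrak{Z}$, continuous. For a $\sigma$-finite measure space $(M,\mathcal{M},\mu)$, a map $\psi:M\to\mathfrak{Z}'$ is $\mathfrak{Z}'$-Gelfand $\mu$-integrable if $x\mapsto\langle\psi(x),z\rangle\in L^1(\mu)$ for every $z\in\mathfrak{Z}$. For such $\psi$ and $E\in\mathcal{M}$, the Gelfand integral $\int_E\psi(x)\,\mu(dx)$ is the element of $\mathfrak{Z}'$ given by $z\mapsto\int_E\langle\psi(x),z\rangle\,\mu(dx)$ (this functional is continuous). Let $\mathcal{F}(M,\mathfrak{Z}')$ be the set of maps from $M$ to $\mathfrak{Z}'$. Given a measurable space $(M,\mathcal{M})$, a map $\xi:\mathcal{M}\to\mathfrak{Z}'$ is an integrator (with measure $\mu$ and map $\Xi$) if there exist a $\sigma$-finite measure $\mu$ on $(M,\mathcal{M})$, a map $\Xi:\mathcal{F}(M,\mathfrak{Z}')\to\mathcal{F}(M,\mathfrak{Z}')$,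 and an element $u\in\mathfrak{Z}'$ (the unit element, regarded as the constant map $x\mapsto u$) such that $\Xi(u)$ is $\mathfrak{Z}'$-Gelfand $\mu$-integrable and $\xi(E)=\int_E\Xi(u)(x)\,\mu(dx)$ for all $E\in\mathcal{M}$. A map $\gamma:M\to\mathfrak{Z}'$ is integrable with respect to $\xi$, written $\gamma\in\mathcal{I}(\xi)$, if $\Xi(\gamma)$ is $\mathfrak{Z}'$-Gelfand $\mu$-integrable; then for $E\in\mathcal{M}$, $\int_E\gamma(x)\,d\xi(x):=\int_E\Xi(\gamma)(x)\,\mu(dx)\in\mathfrak{Z}'$. *)

theory Defs
  imports "HOL-Analysis.Analysis"
begin

text \<open>
  The scalar fields \<open>\<real>\<close> and \<open>\<complex>\<close> are treated uniformly through a type class whose last axiom leaves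
  only these two fields.
\<close>

class real_or_complex = real_normed_field + banach + second_countable_topology +
  assumes real_or_complex:
    "(\<forall>x. \<exists>a. x = a *\<^sub>R 1) \<or> (\<exists>i. i * i = - 1 \<and> (\<forall>x. \<exists>a b. x = a *\<^sub>R 1 + b *\<^sub>R i))"

instance real :: real_or_complex
  by standard simp

instance complex :: real_or_complex
proof
  have "\<i> * \<i> = - 1 \<and> (\<forall>x. \<exists>a b. x = a *\<^sub>R 1 + b *\<^sub>R \<i>)"
    by (auto simp: complex_eq_iff)
  then show "(\<forall>x::complex. \<exists>a. x = a *\<^sub>R 1) \<or>
      (\<exists>i::complex. i * i = - 1 \<and> (\<forall>x. \<exists>a b. x = a *\<^sub>R 1 + b *\<^sub>R i))"
    by blast
qed

text \<open>
  Completeness is taken with respect to the translation-invariant uniformity of the topological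
  vector space: a filter \<open>F\<close> is Cauchy if \<open>x - y\<close> tends to \<open>0\<close> along \<open>F \<times>\<^sub>F F\<close>. No metric is singled out.
  Metrizability includes the Hausdorff property.
\<close>

locale frechet_space = vector_space smul
  for smul :: "'f::real_or_complex \<Rightarrow> 'z::topological_ab_group_add \<Rightarrow> 'z" +
  assumes continuous_smul: "continuous_on UNIV (\<lambda>(a, z). smul a z)"
    and metrizable: "metrizable_space (euclidean :: 'z topology)"
    and complete: "\<And>F :: 'z filter. F \<noteq> bot \<Longrightarrow> filterlim (\<lambda>(x, y). x - y) (nhds 0) (F \<times>\<^sub>F F) \<Longrightarrow>
      \<exists>z. F \<le> nhds z"
    and locally_convex: "\<And>U :: 'z set. open U \<Longrightarrow> 0 \<in> U \<Longrightarrow>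
      \<exists>V. open V \<and> 0 \<in> V \<and> V \<subseteq> U \<and>
        (\<forall>x\<in>V. \<forall>y\<in>V. \<forall>t\<in>{0..1}. smul (of_real (1 - t)) x + smul (of_real t) y \<in> V)"

definition dual ::
  "('f::real_or_complex \<Rightarrow> 'z::topological_ab_group_add \<Rightarrow> 'z) \<Rightarrow> ('z \<Rightarrow> 'f) set" where
  "dual smul = {z'. Vector_Spaces.linear smul (*) z' \<and> continuous_on UNIV z'}"

definition weak_star ::
  "('f::real_or_complex \<Rightarrow> 'z::topological_ab_group_add \<Rightarrow> 'z) \<Rightarrow> ('z \<Rightarrow> 'f) topology" where
  "weak_star smul = topology_generated_by {{z' \<in> dual smul. z' z \<in> U} | z U. open U}"

text \<open>
  Maps defined on \<open>space M\<close> only, represented by functions that are \<open>undefined\<close> elsewhere.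
\<close>

definition dual_maps ::
  "('f::real_or_complex \<Rightarrow> 'z::topological_ab_group_add \<Rightarrow> 'z) \<Rightarrow> 'm measure \<Rightarrow> ('m \<Rightarrow> 'z \<Rightarrow> 'f) set" where
  "dual_maps smul M = space M \<rightarrow>\<^sub>E dual smul"

definition gelfand_integrable ::
  "('f::real_or_complex \<Rightarrow> 'z::topological_ab_group_add \<Rightarrow> 'z) \<Rightarrow> 'm measure \<Rightarrow> ('m \<Rightarrow> 'z \<Rightarrow> 'f) \<Rightarrow> bool" where
  "gelfand_integrable smul \<mu> \<psi> \<longleftrightarrow>
     \<psi> \<in> dual_maps smul \<mu> \<and> (\<forall>z. integrable \<mu> (\<lambda>x. \<psi> x z))"

definition gelfand_integral ::
  "'m measure \<Rightarrow> 'm set \<Rightarrow> ('m \<Rightarrow> 'z \<Rightarrow> 'f::real_or_complex) \<Rightarrow> 'z \<Rightarrow> 'f" where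
  "gelfand_integral \<mu> E \<psi> = (\<lambda>z. set_lebesgue_integral \<mu> E (\<lambda>x. \<psi> x z))"

text \<open>
  \<open>M\<close> serves only as a measurable space: its own measure plays no role.
\<close>

definition integrator_with ::
  "('f::real_or_complex \<Rightarrow> 'z::topological_ab_group_add \<Rightarrow> 'z) \<Rightarrow> 'm measure \<Rightarrow> 'm measure \<Rightarrow>
    (('m \<Rightarrow> 'z \<Rightarrow> 'f) \<Rightarrow> 'm \<Rightarrow> 'z \<Rightarrow> 'f) \<Rightarrow> ('m set \<Rightarrow> 'z \<Rightarrow> 'f) \<Rightarrow> bool" where
  "integrator_with smul M \<mu> \<Xi> \<xi> \<longleftrightarrow>
     sets \<mu> = sets M \<and> sigma_finite_measure \<mu> \<and>
     \<Xi> \<in> dual_maps smul M \<rightarrow> dual_maps smul M \<and>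
     \<xi> \<in> sets M \<rightarrow> dual smul \<and>
     (\<exists>u\<in>dual smul.
        gelfand_integrable smul \<mu> (\<Xi> (\<lambda>x\<in>space M. u)) \<and>
        (\<forall>E\<in>sets M. \<xi> E = gelfand_integral \<mu> E (\<Xi> (\<lambda>x\<in>space M. u))))"

text \<open>
  \<open>\<I>(\<xi>)\<close> and \<open>\<integral>\<^sub>E \<gamma> d\<xi>\<close> depend on \<open>\<xi>\<close> only through the data \<open>\<mu>\<close> and \<open>\<Xi>\<close> it comes with.
\<close>

definition integrator_integrable ::
  "('f::real_or_complex \<Rightarrow> 'z::topological_ab_group_add \<Rightarrow> 'z) \<Rightarrow> 'm measure \<Rightarrow>
    (('m \<Rightarrow> 'z \<Rightarrow> 'f) \<Rightarrow> 'm \<Rightarrow> 'z \<Rightarrow> 'f) \<Rightarrow> ('m \<Rightarrow> 'z \<Rightarrow> 'f) set" where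
  "integrator_integrable smul \<mu> \<Xi> = {\<gamma> \<in> dual_maps smul \<mu>. gelfand_integrable smul \<mu> (\<Xi> \<gamma>)}"

definition integrator_integral ::
  "'m measure \<Rightarrow> (('m \<Rightarrow> 'z \<Rightarrow> 'f::real_or_complex) \<Rightarrow> 'm \<Rightarrow> 'z \<Rightarrow> 'f) \<Rightarrow> 'm set \<Rightarrow>
    ('m \<Rightarrow> 'z \<Rightarrow> 'f) \<Rightarrow> 'z \<Rightarrow> 'f" where
  "integrator_integral \<mu> \<Xi> E \<gamma> = gelfand_integral \<mu> E (\<Xi> \<gamma>)"

end

theory Submission
  imports Defs
begin

text \<open>
  The limit statements are the dominated convergence theorem applied to \<open>x \<mapsto> \<langle>\<Xi>\<^sub>k(\<gamma>)(x), z\<rangle>\<close> for each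
  fixed \<open>z\<close>, because convergence in the weak star topology is pointwise convergence
  (\<open>limitin_weak_star\<close>).

  What needs an argument is that a Gelfand integral is a continuous functional
  (\<open>gelfand_integral_in_dual\<close>). For a Gelfand integrable \<open>\<psi>\<close> put \<open>p(z) = \<integral> \<bar>\<langle>\<psi>(x), z\<rangle>\<bar> \<mu>(dx)\<close>, a finite
  seminorm that dominates \<open>z \<mapsto> \<bar>\<integral>\<^sub>E \<langle>\<psi>(x), z\<rangle> \<mu>(dx)\<bar>\<close>. By Fatou's lemma \<open>p\<close> is lower semicontinuous, so
  the sets \<open>{p \<le> n}\<close> are closed, and they cover the space. By Baire's theorem one of them contains
  \<open>x + V\<close> with \<open>V\<close> an open neighbourhood of \<open>0\<close>, so \<open>p \<le> 2n\<close> on \<open>V\<close>, and a linear functional that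
  is bounded on a neighbourhood of \<open>0\<close> is continuous.

  The completeness at hand concerns the uniformity of the group and no invariant metric is given.
  Baire's theorem is therefore proved directly (\<open>complete_group_Baire\<close>), with a sequence \<open>U\<^sub>n\<close> of
  neighbourhoods of \<open>0\<close> in place of balls.
\<close>

section \<open>Baire's theorem in complete metrizable abelian groups\<close>

text \<open>
  The inclusions \<open>U\<^sub>n\<^sub>+\<^sub>1 + U\<^sub>n\<^sub>+\<^sub>1 \<subseteq> U\<^sub>n\<close> play the part of the triangle inequality for balls of halved radius.
\<close>

lemma metrizable_group_nhds_base:
  assumes "metrizable_space (euclidean :: 'a::topological_ab_group_add topology)"
  obtains U :: "nat \<Rightarrow> 'a::topological_ab_group_add set" where
    "\<And>n. open (U n)" "\<And>n. 0 \<in> U n"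
    "\<And>n a b. a \<in> U (Suc n) \<Longrightarrow> b \<in> U (Suc n) \<Longrightarrow> a + b \<in> U n"
    "\<And>n a b. a \<in> U (Suc n) \<Longrightarrow> b \<in> U (Suc n) \<Longrightarrow> a - b \<in> U n"
    "\<And>W. open W \<Longrightarrow> 0 \<in> W \<Longrightarrow> \<exists>n. U n \<subseteq> W"
proof -
  have "first_countable (euclidean :: 'a topology)"
    using assms by (rule metrizable_imp_first_countable)
  then have "\<exists>\<B>. countable \<B> \<and> (\<forall>V\<in>\<B>. open V) \<and>
      (\<forall>W. open W \<and> (0::'a) \<in> W \<longrightarrow> (\<exists>V\<in>\<B>. 0 \<in> V \<and> V \<subseteq> W))"
    unfolding first_countable_def by simp
  then obtain \<B> :: "'a set set" where "countable \<B>"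
    and \<B>_open: "\<forall>V\<in>\<B>. open V"
    and \<B>_base: "\<forall>W. open W \<and> 0 \<in> W \<longrightarrow> (\<exists>V\<in>\<B>. 0 \<in> V \<and> V \<subseteq> W)"
    by (elim exE conjE)
  define \<B>' where "\<B>' = {V \<in> \<B>. 0 \<in> V}"
  have "countable \<B>'" "\<B>' \<noteq> {}"
    using \<open>countable \<B>\<close> \<B>_base[rule_format, of UNIV] by (auto simp: \<B>'_def)
  define B where "B = from_nat_into \<B>'"
  have range_B: "range B = \<B>'"
    using \<open>countable \<B>'\<close> \<open>\<B>' \<noteq> {}\<close> by (simp add: B_def range_from_nat_into)
  have B_in: "B n \<in> \<B>'" for n
    using range_B by blast
  have B_open: "open (B n)" and B_0: "0 \<in> B n" for n
    using B_in[of n] \<B>_open by (auto simp: \<B>'_def)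
  have B_base: "\<exists>n. B n \<subseteq> W" if W: "open W" "0 \<in> W" for W
  proof -
    obtain V where "V \<in> \<B>'" "V \<subseteq> W"
      using \<B>_base W by (auto simp: \<B>'_def)
    then show ?thesis
      using range_B by (metis imageE)
  qed
  have refine: "\<exists>W. open W \<and> 0 \<in> W \<and> W \<subseteq> B m \<and> (\<forall>a\<in>W. \<forall>b\<in>W. a + b \<in> V \<and> a - b \<in> V)"
    if V: "open V" "0 \<in> V" for V and m
  proof -
    have "((\<lambda>x::'a \<times> 'a. fst x + snd x) \<longlongrightarrow> 0 + 0) (nhds (0, 0))"
      "((\<lambda>x::'a \<times> 'a. fst x - snd x) \<longlongrightarrow> 0 - 0) (nhds (0, 0))"
      by (intro tendsto_intros tendsto_fst[where a="(0,0)", simplified]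
          tendsto_snd[where a="(0,0)", simplified] filterlim_ident)+
    then have "eventually (\<lambda>x::'a \<times> 'a. fst x + snd x \<in> V) (nhds (0, 0))"
      "eventually (\<lambda>x::'a \<times> 'a. fst x - snd x \<in> V) (nhds (0, 0))"
      using V by (auto dest: topological_tendstoD)
    then have "eventually (\<lambda>x::'a \<times> 'a. fst x + snd x \<in> V \<and> fst x - snd x \<in> V) (nhds 0 \<times>\<^sub>F nhds 0)"
      by (simp add: nhds_prod eventually_conj)
    then obtain P Q where P: "eventually P (nhds (0::'a))" and Q: "eventually Q (nhds (0::'a))"
      and PQ: "\<And>a b. P a \<Longrightarrow> Q b \<Longrightarrow> a + b \<in> V \<and> a - b \<in> V"
      unfolding eventually_prod_filter by auto
    obtain S T where "open S" "0 \<in> S" "\<forall>x\<in>S. P x" "open T" "0 \<in> T" "\<forall>x\<in>T. Q x"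
      using P Q unfolding eventually_nhds by auto
    then show ?thesis
      using PQ B_open[of m] B_0[of m] by (intro exI[of _ "S \<inter> T \<inter> B m"]) auto
  qed
  have "\<exists>U. \<forall>n. (open (U n) \<and> 0 \<in> U n \<and> U n \<subseteq> B n) \<and>
      (\<forall>a\<in>U (Suc n). \<forall>b\<in>U (Suc n). a + b \<in> U n \<and> a - b \<in> U n)"
  proof (rule dependent_nat_choice)
    show "\<exists>V. open V \<and> 0 \<in> V \<and> V \<subseteq> B 0"
      using B_open B_0 by blast
    show "\<exists>W. (open W \<and> 0 \<in> W \<and> W \<subseteq> B (Suc n)) \<and> (\<forall>a\<in>W. \<forall>b\<in>W. a + b \<in> V \<and> a - b \<in> V)"
      if "open V \<and> 0 \<in> V \<and> V \<subseteq> B n" for V n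
      using refine[of V "Suc n"] that by (simp only: conj_assoc simp_thms)
  qed
  then obtain U where U: "\<forall>n. (open (U n) \<and> 0 \<in> U n \<and> U n \<subseteq> B n) \<and>
      (\<forall>a\<in>U (Suc n). \<forall>b\<in>U (Suc n). a + b \<in> U n \<and> a - b \<in> U n)"
    by (rule exE)
  show thesis
  proof (rule that[of U])
    show "open (U n)" "0 \<in> U n" for n
      using U by auto
    show "a + b \<in> U n" "a - b \<in> U n" if "a \<in> U (Suc n)" "b \<in> U (Suc n)" for n a b
      using U that by auto
    show "\<exists>n. U n \<subseteq> W" if W: "open W" "0 \<in> W" for W
    proof -
      obtain n where "B n \<subseteq> W"
        using B_base[OF W] by blast
      then show ?thesis
        using U by blast
    qed
  qed
qed

text \<open>Completeness is that of the translation-invariant uniformity, in terms of Cauchy filters.\<close>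

theorem complete_group_Baire:
  fixes C :: "nat \<Rightarrow> 'a::topological_ab_group_add set"
  assumes metrizable: "metrizable_space (euclidean :: 'a topology)"
    and complete: "\<And>F :: 'a filter. F \<noteq> bot \<Longrightarrow>
      filterlim (\<lambda>(x, y). x - y) (nhds 0) (F \<times>\<^sub>F F) \<Longrightarrow> \<exists>z. F \<le> nhds z"
    and closed: "\<And>n. closed (C n)"
    and cover: "(\<Union>n. C n) = UNIV"
  shows "\<exists>n. interior (C n) \<noteq> {}"
proof (rule ccontr)
  assume "\<not> ?thesis"
  then have no_interior: "interior (C n) = {}" for n
    by blast
  obtain U :: "nat \<Rightarrow> 'a set" where
    U_open: "\<And>n. open (U n)" and U_0: "\<And>n. 0 \<in> U n"
    and U_add: "\<And>n a b. a \<in> U (Suc n) \<Longrightarrow> b \<in> U (Suc n) \<Longrightarrow> a + b \<in> U n"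
    and U_diff: "\<And>n a b. a \<in> U (Suc n) \<Longrightarrow> b \<in> U (Suc n) \<Longrightarrow> a - b \<in> U n"
    and U_base: "\<And>W. open W \<Longrightarrow> 0 \<in> W \<Longrightarrow> \<exists>n. U n \<subseteq> W"
    using metrizable_group_nhds_base[OF metrizable] by metis
  have "U (Suc n) \<subseteq> U n" for n
    using U_add[of _ n 0] U_0 by fastforce
  then have U_anti: "U n \<subseteq> U m" if "m \<le> n" for m n
    using that by (rule lift_Suc_antimono_le)
  have translate: "open ((+) a ` U n)" for a n
  proof -
    have "(+) a ` U n = (\<lambda>x. x - a) -` U n"
      by (auto simp: image_iff intro!: bexI[of _ "_ - a"])
    moreover have "open ((\<lambda>x. x - a) -` U n)"
      using U_open by (intro open_vimage continuous_intros) auto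
    ultimately show ?thesis
      by simp
  qed
  \<comment> \<open>A pair \<open>(a, k)\<close> stands for the neighbourhood \<open>a + U k\<close>. The next pair \<open>(a', Suc l)\<close> keeps even
    the larger set \<open>a' + U l\<close> away from \<open>C n\<close>: the limit need not lie in \<open>a' + U (Suc l)\<close>, only in its
    closure, which is contained in \<open>a' + U l\<close>.\<close>
  have step: "\<exists>y. (fst y - fst x \<in> U (Suc (snd x)) \<and> Suc (snd x) \<le> snd y \<and>
      (\<exists>l. snd y = Suc l \<and> (\<forall>w\<in>U l. fst y + w \<notin> C n)))" for x :: "'a \<times> nat" and n
  proof -
    have "\<not> (+) (fst x) ` U (Suc (snd x)) \<subseteq> C n"
      using interior_maximal[OF _ translate, of "fst x" "Suc (snd x)" "C n"] no_interior[of n]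
        U_0[of "Suc (snd x)"] by auto
    then obtain v where v: "v \<in> U (Suc (snd x))" "fst x + v \<notin> C n"
      by blast
    have "open ((\<lambda>w. (fst x + v) + w) -` (- C n))"
      using closed[of n] by (intro open_vimage continuous_intros) auto
    then obtain l where l: "U l \<subseteq> (\<lambda>w. (fst x + v) + w) -` (- C n)"
      using U_base[of "(\<lambda>w. (fst x + v) + w) -` (- C n)"] v by auto
    let ?l = "max l (snd x)"
    have "U ?l \<subseteq> U l"
      by (rule U_anti) simp
    then have "\<forall>w\<in>U ?l. fst x + v + w \<notin> C n"
      using l by blast
    then show ?thesis
      using v by (intro exI[of _ "(fst x + v, Suc ?l)"]) auto
  qed
  obtain s :: "nat \<Rightarrow> 'a \<times> nat" where
    s: "\<And>n. fst (s (Suc n)) - fst (s n) \<in> U (Suc (snd (s n))) \<and> Suc (snd (s n)) \<le> snd (s (Suc n)) \<and>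
      (\<exists>l. snd (s (Suc n)) = Suc l \<and> (\<forall>w\<in>U l. fst (s (Suc n)) + w \<notin> C n))"
    using dependent_nat_choice[of "\<lambda>_ _. True"
        "\<lambda>n x y. fst y - fst x \<in> U (Suc (snd x)) \<and> Suc (snd x) \<le> snd y \<and>
          (\<exists>l. snd y = Suc l \<and> (\<forall>w\<in>U l. fst y + w \<notin> C n))"] step by auto
  define x k where "x n = fst (s n)" and "k n = snd (s n)" for n
  have x_step: "x (Suc n) - x n \<in> U (Suc (k n))" and k_step: "Suc (k n) \<le> k (Suc n)" for n
    using s[of n] by (auto simp: x_def k_def)
  have k_ge: "n \<le> k n" for n
    by (induction n) (use k_step in \<open>auto intro: order_trans\<close>)
  have tail: "x (n + j) - x n \<in> U (k n)" for n j
  proof (induction j arbitrary: n)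
    case 0
    then show ?case using U_0 by simp
  next
    case (Suc j)
    have "x (Suc n + j) - x (Suc n) \<in> U (Suc (k n))"
      using Suc[of "Suc n"] U_anti[OF k_step] by blast
    from U_add[OF this x_step] show ?case
      by (simp add: algebra_simps)
  qed
  have "filterlim (\<lambda>(x, y). x - y) (nhds 0) (filtermap x sequentially \<times>\<^sub>F filtermap x sequentially)"
    unfolding tendsto_def
  proof (intro allI impI)
    fix W :: "'a set" assume "open W" "0 \<in> W"
    then obtain m where m: "U m \<subseteq> W"
      using U_base by blast
    let ?n = "Suc m"
    have "eventually (\<lambda>y. y - x ?n \<in> U ?n) (filtermap x sequentially)"
      unfolding eventually_filtermap eventually_sequentially
    proof (intro exI allI impI)
      fix i assume "?n \<le> i"
      then show "x i - x ?n \<in> U ?n"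
        using tail[of ?n "i - ?n"] U_anti[OF k_ge[of ?n]] by auto
    qed
    moreover have "a - b \<in> W" if "a - x ?n \<in> U ?n" "b - x ?n \<in> U ?n" for a b
      using U_diff[OF that] m by auto
    ultimately show "eventually (\<lambda>y. (case y of (x, y) \<Rightarrow> x - y) \<in> W)
        (filtermap x sequentially \<times>\<^sub>F filtermap x sequentially)"
      unfolding eventually_prod_filter by auto
  qed
  then obtain y where "filtermap x sequentially \<le> nhds y"
    using complete[of "filtermap x sequentially"] by (auto simp: filtermap_bot_iff)
  then have lim: "x \<longlonglongrightarrow> y"
    by (simp add: filterlim_def)
  have "y \<notin> C n" for n
  proof -
    obtain l where l: "k (Suc n) = Suc l" "\<And>w. w \<in> U l \<Longrightarrow> x (Suc n) + w \<notin> C n"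
      using s[of n] by (auto simp: x_def k_def)
    have "(\<lambda>i. y - x (i + Suc n)) \<longlonglongrightarrow> y - y"
      by (intro tendsto_intros LIMSEQ_ignore_initial_segment lim)
    then have "eventually (\<lambda>i. y - x (i + Suc n) \<in> U (Suc l)) sequentially"
      using U_open U_0 by (auto dest: topological_tendstoD)
    then obtain i where i: "y - x (i + Suc n) \<in> U (Suc l)"
      by (auto simp: eventually_sequentially)
    have "y - x (Suc n) \<in> U l"
      using U_add[OF i, of "x (Suc n + i) - x (Suc n)"] tail[of "Suc n" i] l(1)
      by (simp add: add.commute)
    from l(2)[OF this] show ?thesis
      by simp
  qed
  then show False
    using cover by blast
qed

lemma metrizable_group_closed_sequentially:
  fixes S :: "'a::topological_ab_group_add set"
  assumes "metrizable_space (euclidean :: 'a topology)"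
    and limits: "\<And>s a. (\<And>n::nat. s n \<in> S) \<Longrightarrow> s \<longlonglongrightarrow> a \<Longrightarrow> a \<in> S"
  shows "closed S"
proof -
  obtain U :: "nat \<Rightarrow> 'a set" where
    U_open: "\<And>n. open (U n)" and U_0: "\<And>n. 0 \<in> U n"
    and U_add: "\<And>n a b. a \<in> U (Suc n) \<Longrightarrow> b \<in> U (Suc n) \<Longrightarrow> a + b \<in> U n"
    and U_base: "\<And>W. open W \<Longrightarrow> 0 \<in> W \<Longrightarrow> \<exists>n. U n \<subseteq> W"
    using metrizable_group_nhds_base[OF assms(1)] by metis
  have "U (Suc n) \<subseteq> U n" for n
    using U_add[of _ n 0] U_0 by fastforce
  then have U_anti: "U n \<subseteq> U m" if "m \<le> n" for m n
    using that by (rule lift_Suc_antimono_le)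
  have "a \<in> S" if a: "a \<in> closure S" for a
  proof -
    have "\<exists>y. y \<in> S \<and> y - a \<in> U n" for n
    proof -
      have "open ((\<lambda>y. y - a) -` U n)"
        using U_open by (intro open_vimage continuous_intros) auto
      moreover have "a \<in> (\<lambda>y. y - a) -` U n"
        using U_0 by simp
      ultimately have "S \<inter> (\<lambda>y. y - a) -` U n \<noteq> {}"
        using a open_Int_closure_eq_empty[of "(\<lambda>y. y - a) -` U n" S] by blast
      then show ?thesis by blast
    qed
    then obtain s where s: "\<And>n. s n \<in> S" "\<And>n. s n - a \<in> U n"
      by metis
    have "(\<lambda>n. s n - a) \<longlonglongrightarrow> 0"
    proof (rule topological_tendstoI)
      fix W :: "'a set" assume "open W" "0 \<in> W"
      then obtain m where "U m \<subseteq> W"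
        using U_base by blast
      then have "s n - a \<in> W" if "m \<le> n" for n
        using s(2)[of n] U_anti[OF that] by blast
      then show "eventually (\<lambda>n. s n - a \<in> W) sequentially"
        by (auto simp: eventually_sequentially)
    qed
    then have "(\<lambda>n. (s n - a) + a) \<longlonglongrightarrow> 0 + a"
      by (intro tendsto_intros)
    then show ?thesis
      using limits[of s a] s(1) by simp
  qed
  then show ?thesis
    by (metis closure_subset closure_closed closed_closure subsetI subset_antisym)
qed

section \<open>Continuity of the Gelfand integral\<close>

lemma (in frechet_space) linear_bounded_near_0_in_dual:
  fixes f :: "'z \<Rightarrow> 'f" and B :: real
  assumes linear: "Vector_Spaces.linear smul (*) f"
    and V: "open V" "0 \<in> V" and bound: "\<And>v. v \<in> V \<Longrightarrow> norm (f v) \<le> B"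
  shows "f \<in> dual smul"
proof -
  interpret f: Vector_Spaces.linear smul "(*)" f
    by (rule linear)
  have "0 \<le> B"
    using bound[OF V(2)] norm_ge_zero order_trans by blast
  have "(f \<longlongrightarrow> f a) (nhds a)" for a
  proof (rule tendstoI)
    fix e :: real assume "0 < e"
    \<comment> \<open>Scaling by \<open>c\<close> turns the bound \<open>B\<close> on \<open>V\<close> into the bound \<open>e B / (B + 1) < e\<close>, also if \<open>B = 0\<close>.\<close>
    define c :: 'f where "c = of_real ((B + 1) / e)"
    have "continuous_on UNIV (\<lambda>z. smul c (z - a))"
    proof -
      have "continuous_on UNIV (\<lambda>z. (c, z - a))"
        by (intro continuous_intros)
      from continuous_on_compose2[OF continuous_smul this] show ?thesis
        by simp
    qed
    then have "open ((\<lambda>z. smul c (z - a)) -` V)"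
      using V(1) by (simp add: open_vimage)
    moreover have "a \<in> (\<lambda>z. smul c (z - a)) -` V"
      using V(2) by simp
    moreover have "dist (f z) (f a) < e" if "z \<in> (\<lambda>z. smul c (z - a)) -` V" for z
    proof -
      have "norm c * dist (f z) (f a) \<le> B"
        using bound[of "smul c (z - a)"] that
        by (simp add: f.scale f.diff dist_norm norm_mult)
      moreover have "norm c = (B + 1) / e"
        unfolding c_def norm_of_real using \<open>0 < e\<close> \<open>0 \<le> B\<close> by simp
      ultimately have "(B + 1) * dist (f z) (f a) \<le> B * e"
        using \<open>0 < e\<close> by (simp add: field_simps)
      also have "\<dots> < (B + 1) * e"
        using \<open>0 < e\<close> by (simp add: algebra_simps)
      finally show ?thesis
        using \<open>0 \<le> B\<close> by simp
    qed
    ultimately show "eventually (\<lambda>z. dist (f z) (f a) < e) (nhds a)"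
      unfolding eventually_nhds by blast
  qed
  then have "(f \<longlongrightarrow> f a) (at a)" for a
    by (simp only: tendsto_at_iff_tendsto_nhds)
  then have "continuous_on UNIV f"
    by (simp add: continuous_on_def)
  then show ?thesis
    using linear by (simp add: dual_def)
qed

text \<open>The Banach--Steinhaus step: the seminorm \<open>z \<mapsto> \<integral> \<bar>\<langle>\<psi>(x), z\<rangle>\<bar> \<mu>(dx)\<close> is bounded on a neighbourhood of \<open>0\<close>.\<close>

lemma (in frechet_space) gelfand_L1_bounded_near_0:
  fixes \<psi> :: "'m \<Rightarrow> 'z \<Rightarrow> 'f"
  assumes \<psi>: "gelfand_integrable smul \<mu> \<psi>"
  obtains V and B :: real where "open V" "0 \<in> V"
    "\<And>v. v \<in> V \<Longrightarrow> (\<integral>x. norm (\<psi> x v) \<partial>\<mu>) \<le> B"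
proof -
  have int: "integrable \<mu> (\<lambda>x. \<psi> x z)" for z
    using \<psi> by (simp add: gelfand_integrable_def)
  have \<psi>_dual: "\<psi> x \<in> dual smul" if "x \<in> space \<mu>" for x
    using \<psi> that by (auto simp: gelfand_integrable_def dual_maps_def)
  define p where "p z = (\<integral>x. norm (\<psi> x z) \<partial>\<mu>)" for z
  have p_nn: "(\<integral>\<^sup>+x. norm (\<psi> x z) \<partial>\<mu>) = ennreal (p z)" for z
    unfolding p_def by (rule nn_integral_eq_integral) (use int in auto)
  have p_diff: "p (a - b) \<le> p a + p b" for a b
  proof -
    have "p (a - b) \<le> (\<integral>x. norm (\<psi> x a) + norm (\<psi> x b) \<partial>\<mu>)"
      unfolding p_def
    proof (rule integral_mono)
      fix x assume "x \<in> space \<mu>"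
      then interpret \<psi>x: Vector_Spaces.linear smul "(*)" "\<psi> x"
        using \<psi>_dual by (simp add: dual_def)
      show "norm (\<psi> x (a - b)) \<le> norm (\<psi> x a) + norm (\<psi> x b)"
        by (simp add: \<psi>x.diff norm_triangle_ineq4)
    qed (use int in auto)
    also have "\<dots> = p a + p b"
      unfolding p_def by (rule Bochner_Integration.integral_add) (use int in auto)
    finally show ?thesis .
  qed
  have "closed {z. p z \<le> real n}" for n
  proof (rule metrizable_group_closed_sequentially[OF metrizable])
    fix s :: "nat \<Rightarrow> 'z" and a assume s: "\<And>i. s i \<in> {z. p z \<le> real n}" "s \<longlonglongrightarrow> a"
    \<comment> \<open>Lower semicontinuity of \<open>p\<close>: continuity of each \<open>\<psi> x\<close> and Fatou's lemma.\<close>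
    have "ennreal (p a) = (\<integral>\<^sup>+x. liminf (\<lambda>i. ennreal (norm (\<psi> x (s i)))) \<partial>\<mu>)"
      unfolding p_nn[symmetric]
    proof (rule nn_integral_cong)
      fix x assume "x \<in> space \<mu>"
      then have "continuous_on UNIV (\<psi> x)"
        using \<psi>_dual by (simp add: dual_def)
      then have "(\<lambda>i. \<psi> x (s i)) \<longlonglongrightarrow> \<psi> x a"
        using s(2) by (rule continuous_on_tendsto_compose) auto
      then have "(\<lambda>i. ennreal (norm (\<psi> x (s i)))) \<longlonglongrightarrow> ennreal (norm (\<psi> x a))"
        by (intro tendsto_intros)
      then show "ennreal (norm (\<psi> x a)) = liminf (\<lambda>i. ennreal (norm (\<psi> x (s i))))"
        by (intro lim_imp_Liminf[symmetric]) simp_all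
    qed
    also have "\<dots> \<le> liminf (\<lambda>i. \<integral>\<^sup>+x. ennreal (norm (\<psi> x (s i))) \<partial>\<mu>)"
    proof (rule nn_integral_liminf)
      fix i
      have "(\<lambda>x. \<psi> x (s i)) \<in> borel_measurable \<mu>"
        using int by (rule borel_measurable_integrable)
      then show "(\<lambda>x. ennreal (norm (\<psi> x (s i)))) \<in> borel_measurable \<mu>"
        by measurable
    qed
    also have "\<dots> \<le> limsup (\<lambda>i. \<integral>\<^sup>+x. ennreal (norm (\<psi> x (s i))) \<partial>\<mu>)"
      by (rule Liminf_le_Limsup) simp
    also have "\<dots> \<le> ennreal (real n)"
      using s(1) by (intro Limsup_bounded) (auto simp: p_nn intro!: always_eventually ennreal_leI)
    finally show "a \<in> {z. p z \<le> real n}"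
      by simp
  qed
  moreover have "(\<Union>n. {z. p z \<le> real n}) = UNIV"
    using real_arch_simple by auto
  ultimately obtain n where "interior {z. p z \<le> real n} \<noteq> {}"
    using complete_group_Baire[OF metrizable complete, of "\<lambda>n. {z. p z \<le> real n}"] by auto
  then obtain a where a: "a \<in> interior {z. p z \<le> real n}"
    by blast
  define V where "V = (\<lambda>v. v + a) -` interior {z. p z \<le> real n}"
  have "open V"
    unfolding V_def by (intro open_vimage continuous_intros) auto
  moreover have "0 \<in> V"
    using a by (simp add: V_def)
  moreover have "p v \<le> real n + real n" if "v \<in> V" for v
  proof -
    have "p (v + a) \<le> real n" "p a \<le> real n"
      using that a interior_subset by (auto simp: V_def)
    then show ?thesis
      using p_diff[of "v + a" a] by simp
  qed
  ultimately show thesis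
    using that unfolding p_def by blast
qed

lemma (in frechet_space) gelfand_integral_in_dual:
  fixes \<psi> :: "'m \<Rightarrow> 'z \<Rightarrow> 'f"
  assumes \<psi>: "gelfand_integrable smul \<mu> \<psi>" and E: "E \<in> sets \<mu>"
  shows "gelfand_integral \<mu> E \<psi> \<in> dual smul"
proof -
  have int: "integrable \<mu> (\<lambda>x. \<psi> x z)" for z
    using \<psi> by (simp add: gelfand_integrable_def)
  have int_E: "set_integrable \<mu> E (\<lambda>x. \<psi> x z)" for z
    unfolding set_integrable_def using E int by (rule integrable_mult_indicator)
  have linear_\<psi>: "Vector_Spaces.linear smul (*) (\<psi> x)" if "x \<in> space \<mu>" for x
    using \<psi> that by (auto simp: gelfand_integrable_def dual_maps_def dual_def)
  have cong: "(LINT x:E|\<mu>. f x) = (LINT x:E|\<mu>. g x)"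
    if "\<And>x. x \<in> space \<mu> \<Longrightarrow> f x = g x" for f g :: "'m \<Rightarrow> 'f"
    unfolding set_lebesgue_integral_def using that by (intro Bochner_Integration.integral_cong) auto
  have add: "gelfand_integral \<mu> E \<psi> (a + b) = gelfand_integral \<mu> E \<psi> a + gelfand_integral \<mu> E \<psi> b" for a b
  proof -
    have "\<psi> x (a + b) = \<psi> x a + \<psi> x b" if "x \<in> space \<mu>" for x
      using linear_\<psi>[OF that] by (simp add: Vector_Spaces.linear_iff)
    then have "gelfand_integral \<mu> E \<psi> (a + b) = (LINT x:E|\<mu>. \<psi> x a + \<psi> x b)"
      unfolding gelfand_integral_def by (rule cong)
    then show ?thesis
      using int_E by (simp add: gelfand_integral_def set_integral_add)
  qed
  have scale: "gelfand_integral \<mu> E \<psi> (smul c a) = c * gelfand_integral \<mu> E \<psi> a" for c a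
  proof -
    have "\<psi> x (smul c a) = c * \<psi> x a" if "x \<in> space \<mu>" for x
      using linear_\<psi>[OF that] by (simp add: Vector_Spaces.linear_iff)
    then have "gelfand_integral \<mu> E \<psi> (smul c a) = (LINT x:E|\<mu>. c * \<psi> x a)"
      unfolding gelfand_integral_def by (rule cong)
    then show ?thesis
      by (simp add: gelfand_integral_def)
  qed
  have "vector_space ((*) :: 'f \<Rightarrow> 'f \<Rightarrow> 'f)"
    by standard (simp_all add: algebra_simps)
  then have linear: "Vector_Spaces.linear smul (*) (gelfand_integral \<mu> E \<psi>)"
    using add scale vector_space_axioms by (simp add: Vector_Spaces.linear_iff)
  obtain V and B :: real where V: "open V" "0 \<in> V"
    and B: "\<And>v. v \<in> V \<Longrightarrow> (\<integral>x. norm (\<psi> x v) \<partial>\<mu>) \<le> B"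
    using gelfand_L1_bounded_near_0[OF \<psi>] by blast
  have "norm (gelfand_integral \<mu> E \<psi> v) \<le> B" if "v \<in> V" for v
  proof -
    have "norm (gelfand_integral \<mu> E \<psi> v) \<le> (\<integral>x. norm (indicator E x *\<^sub>R \<psi> x v) \<partial>\<mu>)"
      unfolding gelfand_integral_def set_lebesgue_integral_def by (rule integral_norm_bound)
    also have "\<dots> \<le> (\<integral>x. norm (\<psi> x v) \<partial>\<mu>)"
    proof (rule integral_mono)
      show "integrable \<mu> (\<lambda>x. norm (indicator E x *\<^sub>R \<psi> x v))"
        using int_E[of v] unfolding set_integrable_def by (rule integrable_norm)
      show "integrable \<mu> (\<lambda>x. norm (\<psi> x v))"
        using int by (rule integrable_norm)
    qed (simp split: split_indicator)
    also have "\<dots> \<le> B"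
      using that by (rule B)
    finally show ?thesis .
  qed
  with linear V show ?thesis
    by (rule linear_bounded_near_0_in_dual)
qed

section \<open>Convergence in the weak star topology\<close>

lemma limitin_weak_star:
  fixes f :: "'k \<Rightarrow> 'z::topological_ab_group_add \<Rightarrow> 'f::real_or_complex"
  assumes in_dual: "\<And>k. f k \<in> dual smul"
  shows "limitin (weak_star smul) f l F \<longleftrightarrow> l \<in> dual smul \<and> (\<forall>z. ((\<lambda>k. f k z) \<longlongrightarrow> l z) F)"
proof
  let ?S = "{{z' \<in> dual smul. z' z \<in> U} | z U. open U}"
  have "dual smul \<in> ?S"
    by (intro CollectI exI[of _ undefined] exI[of _ UNIV]) auto
  then have topspace: "topspace (weak_star smul) = dual smul"
    by (auto simp: weak_star_def topology_generated_by_topspace)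
  {
    assume lim: "limitin (weak_star smul) f l F"
    then have l: "l \<in> dual smul"
      using topspace by (simp add: limitin_def)
    have "((\<lambda>k. f k z) \<longlongrightarrow> l z) F" for z
    proof (rule topological_tendstoI)
      fix U :: "'f set" assume U: "open U" "l z \<in> U"
      then have "openin (weak_star smul) {z' \<in> dual smul. z' z \<in> U}"
        unfolding weak_star_def by (intro topology_generated_by_Basis) auto
      then have "eventually (\<lambda>k. f k \<in> {z' \<in> dual smul. z' z \<in> U}) F"
        using lim l U unfolding limitin_def by blast
      then show "eventually (\<lambda>k. f k z \<in> U) F"
        by eventually_elim simp
    qed
    with l show "l \<in> dual smul \<and> (\<forall>z. ((\<lambda>k. f k z) \<longlongrightarrow> l z) F)"
      by simp
  next
    assume lim: "l \<in> dual smul \<and> (\<forall>z. ((\<lambda>k. f k z) \<longlongrightarrow> l z) F)"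
    have "eventually (\<lambda>k. f k \<in> W) F" if "generate_topology_on ?S W" "l \<in> W" for W
      using that
    proof induction
      case (Int a b)
      then show ?case by (simp add: eventually_conj)
    next
      case (UN K)
      then obtain k where "k \<in> K" "l \<in> k" by blast
      then show ?case
        using UN.IH[of k] by (auto elim: eventually_mono)
    next
      case (Basis s)
      then obtain z U where s: "s = {z' \<in> dual smul. z' z \<in> U}" "open U" by blast
      then have "eventually (\<lambda>k. f k z \<in> U) F"
        using Basis lim by (auto intro: topological_tendstoD)
      then show ?case
        using in_dual by (simp add: s)
    qed simp
    then show "limitin (weak_star smul) f l F"
      using lim topspace
      by (simp add: limitin_def weak_star_def openin_topology_generated_by_iff)
  }
qed

section \<open>Limits of integrators\<close>

theorem proposition4p12:
  fixes smul :: "'f::real_or_complex \<Rightarrow> 'z::topological_ab_group_add \<Rightarrow> 'z"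
    and M \<mu> :: "'m measure"
    and \<xi>k :: "nat \<Rightarrow> 'm set \<Rightarrow> 'z \<Rightarrow> 'f"
    and \<Xi>k :: "nat \<Rightarrow> ('m \<Rightarrow> 'z \<Rightarrow> 'f) \<Rightarrow> 'm \<Rightarrow> 'z \<Rightarrow> 'f"
    and \<Xi> :: "('m \<Rightarrow> 'z \<Rightarrow> 'f) \<Rightarrow> 'm \<Rightarrow> 'z \<Rightarrow> 'f"
    and u :: "'z \<Rightarrow> 'f"
    and \<xi> :: "'m set \<Rightarrow> 'z \<Rightarrow> 'f"
  assumes frechet: "frechet_space smul"
    and integrators: "\<And>k. integrator_with smul M \<mu> (\<Xi>k k) (\<xi>k k)"
    and nonempty: "(\<Inter>k. integrator_integrable smul \<mu> (\<Xi>k k)) \<noteq> {}"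
    and map: "\<Xi> \<in> dual_maps smul M \<rightarrow> dual_maps smul M"
    and unit: "u \<in> dual smul"
    and unit_integrable: "gelfand_integrable smul \<mu> (\<Xi> (\<lambda>x\<in>space M. u))"
    and meas: "\<And>\<gamma> z. \<gamma> \<in> (\<Inter>k. integrator_integrable smul \<mu> (\<Xi>k k)) \<Longrightarrow>
      (\<lambda>x. \<Xi> \<gamma> x z) \<in> borel_measurable \<mu>"
    and conv: "\<And>\<gamma>. \<gamma> \<in> (\<Inter>k. integrator_integrable smul \<mu> (\<Xi>k k)) \<Longrightarrow>
      AE x in \<mu>. limitin (weak_star smul) (\<lambda>k. \<Xi>k k \<gamma> x) (\<Xi> \<gamma> x) sequentially"
    and dom: "\<And>\<gamma> z. \<gamma> \<in> (\<Inter>k. integrator_integrable smul \<mu> (\<Xi>k k)) \<Longrightarrow>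
      \<exists>g :: 'm \<Rightarrow> real. (\<forall>x\<in>space M. 0 \<le> g x) \<and> integrable \<mu> g \<and>
        (\<forall>k. AE x in \<mu>. norm (\<Xi>k k \<gamma> x z) \<le> g x)"
    and \<xi>_def: "\<And>E. E \<in> sets M \<Longrightarrow> \<xi> E = gelfand_integral \<mu> E (\<Xi> (\<lambda>x\<in>space M. u))"
  shows "integrator_with smul M \<mu> \<Xi> \<xi> \<and>
    (\<Inter>k. integrator_integrable smul \<mu> (\<Xi>k k)) \<subseteq> integrator_integrable smul \<mu> \<Xi> \<and>
    (\<forall>\<gamma> \<in> (\<Inter>k. integrator_integrable smul \<mu> (\<Xi>k k)).
      limitin (weak_star smul) (\<lambda>k. integrator_integral \<mu> (\<Xi>k k) (space M) \<gamma>)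
        (integrator_integral \<mu> \<Xi> (space M) \<gamma>) sequentially)"
proof -
  interpret frechet_space smul
    by (rule frechet)
  have sets: "sets \<mu> = sets M" and sigma_finite: "sigma_finite_measure \<mu>"
    using integrators[of 0] by (auto simp: integrator_with_def)
  have space: "space \<mu> = space M"
    using sets by (rule sets_eq_imp_space_eq)
  have integrator: "integrator_with smul M \<mu> \<Xi> \<xi>"
    unfolding integrator_with_def
    using sets sigma_finite map unit unit_integrable \<xi>_def
      gelfand_integral_in_dual[OF unit_integrable] by auto
  have limits: "\<gamma> \<in> integrator_integrable smul \<mu> \<Xi> \<and>
      limitin (weak_star smul) (\<lambda>k. integrator_integral \<mu> (\<Xi>k k) (space M) \<gamma>)
        (integrator_integral \<mu> \<Xi> (space M) \<gamma>) sequentially"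
    if \<gamma>: "\<gamma> \<in> (\<Inter>k. integrator_integrable smul \<mu> (\<Xi>k k))" for \<gamma>
  proof -
    have \<gamma>_map: "\<gamma> \<in> dual_maps smul \<mu>"
      and \<Xi>k_int: "gelfand_integrable smul \<mu> (\<Xi>k k \<gamma>)" for k
      using \<gamma> by (auto simp: integrator_integrable_def)
    have \<Xi>_map: "\<Xi> \<gamma> \<in> dual_maps smul \<mu>"
      using \<gamma>_map map by (auto simp: dual_maps_def space)
    have \<Xi>k_dual: "\<Xi>k k \<gamma> x \<in> dual smul" if "x \<in> space \<mu>" for k x
      using \<Xi>k_int[of k] that by (auto simp: gelfand_integrable_def dual_maps_def)
    have pointwise: "AE x in \<mu>. (\<lambda>k. \<Xi>k k \<gamma> x z) \<longlonglongrightarrow> \<Xi> \<gamma> x z" for z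
      using conv[OF \<gamma>] AE_space
      by eventually_elim (simp add: limitin_weak_star \<Xi>k_dual)
    have DCT: "integrable \<mu> (\<lambda>x. \<Xi> \<gamma> x z)"
      "(\<lambda>k. \<integral>x. \<Xi>k k \<gamma> x z \<partial>\<mu>) \<longlonglongrightarrow> (\<integral>x. \<Xi> \<gamma> x z \<partial>\<mu>)" for z
    proof -
      obtain g :: "'m \<Rightarrow> real" where g: "integrable \<mu> g"
        "\<And>k. AE x in \<mu>. norm (\<Xi>k k \<gamma> x z) \<le> g x"
        using dom[OF \<gamma>, of z] by blast
      have "(\<lambda>x. \<Xi>k k \<gamma> x z) \<in> borel_measurable \<mu>" for k
        using \<Xi>k_int[of k] by (simp add: gelfand_integrable_def borel_measurable_integrable)
      note dominated = meas[OF \<gamma>] this g(1) pointwise g(2)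
      show "integrable \<mu> (\<lambda>x. \<Xi> \<gamma> x z)"
        using dominated by (rule integrable_dominated_convergence)
      show "(\<lambda>k. \<integral>x. \<Xi>k k \<gamma> x z \<partial>\<mu>) \<longlonglongrightarrow> (\<integral>x. \<Xi> \<gamma> x z \<partial>\<mu>)"
        using dominated by (rule integral_dominated_convergence)
    qed
    have \<Xi>_int: "gelfand_integrable smul \<mu> (\<Xi> \<gamma>)"
      using \<Xi>_map DCT(1) by (simp add: gelfand_integrable_def)
    have whole: "gelfand_integral \<mu> (space M) \<psi> z = (\<integral>x. \<psi> x z \<partial>\<mu>)"
      if "gelfand_integrable smul \<mu> \<psi>" for \<psi> and z
      using that by (simp add: gelfand_integral_def gelfand_integrable_def set_integral_space
          flip: space)
    have "space M \<in> sets \<mu>"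
      using sets by simp
    then show ?thesis
      using \<gamma>_map \<Xi>_int \<Xi>k_int DCT(2)
      by (simp add: integrator_integrable_def integrator_integral_def limitin_weak_star
          gelfand_integral_in_dual whole)
  qed
  show ?thesis
    using integrator limits by blast
qed

end
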